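(* Let $\Gamma=(V,E,c)$ be a finite connected network, $\lambda\ge 0$, $\omega\in\Omega(V)$ a weight, and $q=q_\omega+\lambda$. Let $\Gamma'=(V',E',c')$, $V'=V\cup\{x'\}$, be the network obtained from $\Gamma$ by adding a new vertex $x'$ joined to distinct vertices $x_1,\dots,x_m\in V$ ($1\le m\le |V|$) with conductances $a_1,\dots,a_m>0$. Let $\omega(x')>0$ be given, and let $\omega'\in\Omega(V')$ be $\omega'(x)=\omega(x)/\sqrt{1+\omega(x')^2}$, $x\in V'$. Let $\mathcal{L}'$ be the Laplacian of $\Gamma'$, $q_{\omega'}=-\frac{1}{\omega'}\mathcal{L}'(\omega')$, $p=q_{\omega'}+\lambda$, and $\mathcal{L}'_p$ the Schr\"odinger operator on $\Gamma'$ with potential $p$. Put $$\rho_i=\sqrt{a_i\,\omega(x_i)\,\omega(x')},\quad \sigma_i=\frac{\rho_i}{\omega(x_i)}\varepsilon_{x_i}\ (i=1,\dots,m),\quad \sigma=\sum_{i=1}^m a_i\varepsilon_{x_i},\quad \alpha=\lambda+\frac{1}{\omega(x')^2}\sum_{i=1}^m\rho_i^2 .$$ Then $$\mathcal{L}'_p=\mathcal{L}_q+\sum_{i=1}^m\mathcal{P}_{\sigma_i}-\mathcal{P}_{\sigma,\varepsilon_{x'}}\ \text{ on } V,\qquad \mathcal{L}'_p=-\mathcal{P}_{\varepsilon_{x'},\sigma}+\alpha\,\mathcal{P}_{\varepsilon_{x'}}\ \text{ on }\{x'\}.$$ That is, for every function $u:V'\to\mathbb{R}$: for all $x\in V$,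 $\mathcal{L}'_p(u)(x)=\mathcal{L}_q(u|_V)(x)+\sum_{i=1}^m\mathcal{P}_{\sigma_i}(u)(x)-\mathcal{P}_{\sigma,\varepsilon_{x'}}(u)(x)$, and $\mathcal{L}'_p(u)(x')=-\mathcal{P}_{\varepsilon_{x'},\sigma}(u)(x')+\alpha\,\mathcal{P}_{\varepsilon_{x'}}(u)(x')$.
   Context: A finite network $\Gamma=(V,E,c)$ is a finite connected graph without loops or multiple edges, with a symmetric conductance $c:V\times V\to[0,\infty)$ such that $c(x,x)=0$ for all $x$, and $x,y$ are adjacent iff $c(x,y)>0$. $\mathcal{C}(V)$ is the space of real functions on $V$, with $\langle u,v\rangle=\sum_{x\in V}u(x)v(x)$; $\varepsilon_x$ is the Dirac function at $x$ (value $1$ at $x$ and $0$ elsewhere). A weight is a function $\omega\in\mathcal{C}(V)$ with $\omega(x)>0$ for all $x$ and $\langle\omega,\omega\rangle=1$; $\Omega(V)$ is the set of weights. The Laplacian of $\Gamma$ is $\mathcal{L}(u)(x)=\sum_{y\in V}c(x,y)[u(x)-u(y)]$. The Schr\"odinger operator with potential $q\in\mathcal{C}(V)$ is $\mathcal{L}_q(u)=\mathcal{L}(u)+qu$. The potential determined by a weight $\omega$ is $q_\omega=-\frac{1}{\omega}\mathcal{L}(\omega)$. The same definitions apply to $\Gamma'$ and $V'$. The network $\Gamma'$ has edge set $E'=E\cup\{e_{x_1x'},\dots,e_{x_mx'}\}$ and symmetric conductance $c'$ with $c'(x,y)=c(x,y)$ for $x,y\in V$, $c'(x_i,x')=c'(x',x_i)=a_i$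 for $i=1,\dots,m$, and $c'=0$ otherwise. For functions $\sigma,\tau$, $\mathcal{P}_{\sigma,\tau}$ is the operator $\mathcal{P}_{\sigma,\tau}(u)=\langle\tau,u\rangle\sigma$, and $\mathcal{P}_\sigma=\mathcal{P}_{\sigma,\sigma}$. Functions on $V$ such as $\sigma$ and $\sigma_i$ are regarded as functions on $V'$ vanishing at $x'$ where needed. *)

theory Defs
  imports Complex_Main "HOL-Library.FuncSet" "Graph_Theory.Graph_Theory"
begin

text \<open>
  A finite simple graph is a \<^locale>\<open>pair_graph\<close>: an undirected edge between \<open>u\<close> and \<open>v\<close> is
  represented by the two arcs \<open>(u, v)\<close> and \<open>(v, u)\<close>. Conductances, potentials, weights and the
  functions in $C(V)$ are total functions on the ambient type of which only the values on the
  vertices matter.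
\<close>

locale finite_network = pair_graph G for G :: "'a pair_pre_digraph" +
  fixes c :: "'a \<Rightarrow> 'a \<Rightarrow> real"
  assumes connected_graph: "connected G"
    and cond_nonneg: "u \<in> pverts G \<Longrightarrow> v \<in> pverts G \<Longrightarrow> 0 \<le> c u v"
    and cond_sym: "u \<in> pverts G \<Longrightarrow> v \<in> pverts G \<Longrightarrow> c u v = c v u"
    and cond_diag: "v \<in> pverts G \<Longrightarrow> c v v = 0"
    and adjacent_iff: "u \<in> pverts G \<Longrightarrow> v \<in> pverts G \<Longrightarrow> (u, v) \<in> parcs G \<longleftrightarrow> 0 < c u v"

definition inner_on :: "'a set \<Rightarrow> ('a \<Rightarrow> real) \<Rightarrow> ('a \<Rightarrow> real) \<Rightarrow> real" where
  "inner_on V u v = (\<Sum>y\<in>V. u y * v y)"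

definition dirac :: "'a \<Rightarrow> 'a \<Rightarrow> real" where
  "dirac z = (\<lambda>y. if y = z then 1 else 0)"

definition weights :: "'a set \<Rightarrow> ('a \<Rightarrow> real) set" where
  "weights V = {\<omega>. (\<forall>y\<in>V. 0 < \<omega> y) \<and> inner_on V \<omega> \<omega> = 1}"

definition laplacian :: "'a set \<Rightarrow> ('a \<Rightarrow> 'a \<Rightarrow> real) \<Rightarrow> ('a \<Rightarrow> real) \<Rightarrow> 'a \<Rightarrow> real" where
  "laplacian V c u = (\<lambda>v. \<Sum>y\<in>V. c v y * (u v - u y))"

definition schroedinger ::
    "'a set \<Rightarrow> ('a \<Rightarrow> 'a \<Rightarrow> real) \<Rightarrow> ('a \<Rightarrow> real) \<Rightarrow> ('a \<Rightarrow> real) \<Rightarrow> 'a \<Rightarrow> real" where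
  "schroedinger V c q u = (\<lambda>v. laplacian V c u v + q v * u v)"

definition weight_potential :: "'a set \<Rightarrow> ('a \<Rightarrow> 'a \<Rightarrow> real) \<Rightarrow> ('a \<Rightarrow> real) \<Rightarrow> 'a \<Rightarrow> real" where
  "weight_potential V c \<omega> = (\<lambda>v. - (1 / \<omega> v) * laplacian V c \<omega> v)"

text \<open>The operator $P_{\sigma,\tau}$; the inner product is taken over the vertex set \<open>V\<close>.\<close>

definition proj2 :: "'a set \<Rightarrow> ('a \<Rightarrow> real) \<Rightarrow> ('a \<Rightarrow> real) \<Rightarrow> ('a \<Rightarrow> real) \<Rightarrow> 'a \<Rightarrow> real" where
  "proj2 V \<sigma> \<tau> u = (\<lambda>v. inner_on V \<tau> u * \<sigma> v)"

abbreviation proj1 :: "'a set \<Rightarrow> ('a \<Rightarrow> real) \<Rightarrow> ('a \<Rightarrow> real) \<Rightarrow> 'a \<Rightarrow> real" where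
  "proj1 V \<sigma> \<equiv> proj2 V \<sigma> \<sigma>"

definition add_vertex ::
    "'a pair_pre_digraph \<Rightarrow> 'a \<Rightarrow> nat \<Rightarrow> (nat \<Rightarrow> 'a) \<Rightarrow> 'a pair_pre_digraph" where
  "add_vertex G x' m x =
    \<lparr> pverts = pverts G \<union> {x'},
      parcs = parcs G \<union> (\<Union>i\<in>{1..m}. {(x i, x'), (x', x i)}) \<rparr>"

text \<open>The description selects the index of the new edge between \<open>u\<close> and \<open>v\<close>; it is unique when
  \<open>x\<close> is injective on \<open>{1..m}\<close> and \<open>x'\<close> is not a vertex of \<open>G\<close>.\<close>

definition add_vertex_cond ::
    "'a pair_pre_digraph \<Rightarrow> ('a \<Rightarrow> 'a \<Rightarrow> real) \<Rightarrow> 'a \<Rightarrow> nat \<Rightarrow> (nat \<Rightarrow> 'a) \<Rightarrow> (nat \<Rightarrow> real) \<Rightarrow>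
      'a \<Rightarrow> 'a \<Rightarrow> real" where
  "add_vertex_cond G c x' m x a = (\<lambda>u v.
     if u \<in> pverts G \<and> v \<in> pverts G then c u v
     else if \<exists>i\<in>{1..m}. {u, v} = {x i, x'}
       then a (THE i. i \<in> {1..m} \<and> {u, v} = {x i, x'})
     else 0)"

context
  fixes G :: "'a pair_pre_digraph" and c :: "'a \<Rightarrow> 'a \<Rightarrow> real"
    and x' :: 'a and m :: nat and x :: "nat \<Rightarrow> 'a" and a :: "nat \<Rightarrow> real"
  assumes new: "x' \<notin> pverts G"
    and inj: "inj_on x {1..m}"
    and range: "x ` {1..m} \<subseteq> pverts G"
begin

lemma add_vertex_cond_old:
  "u \<in> pverts G \<Longrightarrow> v \<in> pverts G \<Longrightarrow> add_vertex_cond G c x' m x a u v = c u v"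
  by (simp add: add_vertex_cond_def)

lemma add_vertex_cond_new:
  assumes i: "i \<in> {1..m}"
  shows "add_vertex_cond G c x' m x a (x i) x' = a i"
    and "add_vertex_cond G c x' m x a x' (x i) = a i"
proof -
  have *: "(THE j. j \<in> {1..m} \<and> {x i, x'} = {x j, x'}) = i"
    using i inj by (intro the_equality) (auto simp: doubleton_eq_iff dest: inj_onD)
  show "add_vertex_cond G c x' m x a (x i) x' = a i"
    using new i * by (auto simp: add_vertex_cond_def)
  have **: "(THE j. j \<in> {1..m} \<and> {x', x i} = {x j, x'}) = i"
    using i inj by (intro the_equality) (auto simp: doubleton_eq_iff dest: inj_onD)
  show "add_vertex_cond G c x' m x a x' (x i) = a i"
    using new i ** by (auto simp: add_vertex_cond_def)
qed

lemma add_vertex_cond_zero: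
  assumes "\<not> (u \<in> pverts G \<and> v \<in> pverts G)" and "\<forall>i\<in>{1..m}. {u, v} \<noteq> {x i, x'}"
  shows "add_vertex_cond G c x' m x a u v = 0"
  using assms by (auto simp: add_vertex_cond_def)

lemma finite_network_add_vertex:
  assumes net: "finite_network G c" and m: "1 \<le> m" and pos: "\<forall>i\<in>{1..m}. 0 < a i"
  shows "finite_network (add_vertex G x' m x) (add_vertex_cond G c x' m x a)"
proof -
  interpret finite_network G c by (rule net)
  let ?G = "add_vertex G x' m x" and ?c = "add_vertex_cond G c x' m x a"
  have V: "pverts ?G = insert x' (pverts G)"
    and E: "parcs ?G = parcs G \<union> (\<Union>i\<in>{1..m}. {(x i, x'), (x', x i)})"
    by (simp_all add: add_vertex_def)
  have xV: "x i \<in> pverts G" if "i \<in> {1..m}" for i using range that by auto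
  have sG: "sym (parcs G)" using pair_sym_arcs by (simp add: symmetric_def)
  interpret H: pair_graph ?G
  proof
    show "symmetric ?G" using sG by (auto simp: symmetric_def E sym_def)
  qed (use new xV in \<open>auto simp: V E dest: wellformed' no_loops\<close>)
  have sc: "strongly_connected G"
    using connected_graph by (rule symmetric_connected_imp_strongly_connected[rotated]) (rule pair_sym_arcs)
  have sub: "subgraph (with_proj G) (with_proj ?G)"
    by (auto simp: subgraph_def compatible_def V E) unfold_locales
  have old: "u \<rightarrow>\<^sup>*\<^bsub>?G\<^esub> v" if "u \<in> pverts G" "v \<in> pverts G" for u v
    using sc that by (auto intro!: pre_digraph.reachable_mono[OF _ sub])
  have x1: "x 1 \<in> pverts G" "(x 1, x') \<in> parcs ?G" "(x' , x 1) \<in> parcs ?G"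
    using m xV by (auto simp: E)
  have r: "u \<rightarrow>\<^sup>*\<^bsub>?G\<^esub> x 1 \<and> x 1 \<rightarrow>\<^sup>*\<^bsub>?G\<^esub> u" if "u \<in> pverts ?G" for u
    using that x1 old H.reachable_adjI by (auto simp: V)
  have "strongly_connected ?G"
    using r by (intro strongly_connectedI) (auto simp: V intro: H.reachable_trans)
  then have con: "connected ?G"
    unfolding connected_def strongly_connected_def
    by (auto intro: H.reachable_mk_symmetricI)
  have old_arcs: "(u, v) \<in> parcs ?G \<longleftrightarrow> (u, v) \<in> parcs G" if "u \<in> pverts G" "v \<in> pverts G" for u v
    using that new by (auto simp: E)
  have new_cond: "?c u x' = ?c x' u \<and> 0 \<le> ?c u x' \<and> 0 \<le> ?c x' u \<and> ((u, x') \<in> parcs ?G \<longleftrightarrow> 0 < ?c u x')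
      \<and> ((x', u) \<in> parcs ?G \<longleftrightarrow> 0 < ?c x' u)" if u: "u \<in> pverts G" for u
  proof (cases "u \<in> x ` {1..m}")
    case True
    then obtain i where "i \<in> {1..m}" "u = x i" by auto
    then show ?thesis using add_vertex_cond_new[of i] pos by (auto simp: E less_imp_le)
  next
    case False
    have "?c u x' = 0" "?c x' u = 0"
      using False new u by (auto intro!: add_vertex_cond_zero simp: doubleton_eq_iff)
    then show ?thesis using False new by (auto simp: E dest: wellformed')
  qed
  have diag: "?c x' x' = 0" "(x', x') \<notin> parcs ?G"
    using new xV H.no_loops by (fastforce intro!: add_vertex_cond_zero simp: doubleton_eq_iff)+
  show ?thesis
  proof
    show "connected ?G" by (rule con)
  qed (use new_cond diag cond_nonneg cond_sym cond_diag adjacent_iff old_arcs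
        in \<open>auto simp: V add_vertex_cond_old\<close>)
qed

end

lemma extended_weight:
  assumes "finite V" "x' \<notin> V" "\<omega> \<in> weights V" "0 < \<omega> x'"
  shows "(\<lambda>v. \<omega> v / sqrt (1 + (\<omega> x')\<^sup>2)) \<in> weights (V \<union> {x'})"
proof -
  let ?s = "sqrt (1 + (\<omega> x')\<^sup>2)"
  have s: "0 < ?s" "?s * ?s = 1 + (\<omega> x')\<^sup>2" by (simp_all add: add_pos_nonneg)
  have "inner_on (V \<union> {x'}) (\<lambda>v. \<omega> v / ?s) (\<lambda>v. \<omega> v / ?s)
      = (\<Sum>y\<in>insert x' V. \<omega> y * \<omega> y) / (?s * ?s)"
    by (simp add: inner_on_def sum_divide_distrib)
  also have "\<dots> = 1"
    using assms s by (simp add: weights_def inner_on_def power2_eq_square add_nonneg_eq_0_iff)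
  finally show ?thesis using assms s(1) by (auto simp: weights_def)
qed

end

theory Submission
  imports Defs
begin

text \<open>
  Everything rests on $c'(v, x') = c'(x', v) = \<sigma>(v)$ for $v \<in> V$. The new edges add
  $\<sigma>(v)(u(v) - u(x'))$ to the Laplacian at $v$, and the change of potential cancels
  $\<sigma>(v)u(v)$ and leaves $\<sigma>(v)\frac{\<omega>(x')}{\<omega>(v)}u(v)$, which is
  $\sum_i P_{\<sigma>_i}(u)(v)$ since $\<rho>_i^2 = a_i\<omega>(x_i)\<omega>(x')$.
\<close>

text \<open>By linearity of the Laplacian, \<open>s\<close> cancels against the factor
  \<open>1 / \<omega> v\<close>. Hence the potential of \<omega>' can be computed from the
  unnormalised \<omega>, and the square root disappears.\<close>

lemma weight_potential_divide:
  assumes "s \<noteq> 0"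
  shows "weight_potential V c (\<lambda>v. \<omega> v / s) v = weight_potential V c \<omega> v"
proof -
  have "laplacian V c (\<lambda>v. \<omega> v / s) v = laplacian V c \<omega> v / s"
    by (simp add: laplacian_def sum_divide_distrib flip: diff_divide_distrib)
  then show ?thesis
    using assms by (simp add: weight_potential_def)
qed

lemma laplacian_insert:
  assumes "finite V" "z \<notin> V"
  shows "laplacian (insert z V) c u v = laplacian V c u v + c v z * (u v - u z)"
  using assms by (simp add: laplacian_def)

lemma laplacian_cong:
  assumes "\<And>y. y \<in> V \<Longrightarrow> c v y = c' v y" "\<And>y. y \<in> V \<Longrightarrow> u y = u' y" "v \<in> V"
  shows "laplacian V c u v = laplacian V c' u' v"
  using assms by (simp add: laplacian_def)

lemma inner_on_dirac:
  assumes "finite V" "z \<in> V"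
  shows "inner_on V (dirac z) u = u z"
  using assms by (simp add: inner_on_def dirac_def if_distrib[of "\<lambda>t. t * _"] cong: if_cong)

lemma inner_on_scale: "inner_on V (\<lambda>v. k * f v) u = k * inner_on V f u"
  by (simp add: inner_on_def sum_distrib_left mult.assoc)

lemma inner_on_sum: "inner_on V (\<lambda>v. \<Sum>i\<in>I. f i v) u = (\<Sum>i\<in>I. inner_on V (f i) u)"
  unfolding inner_on_def sum_distrib_right by (rule sum.swap)

text \<open>As \<open>x\<close> is injective, at most one term of the sum is nonzero, namely the one
  whose index the description in \<open>add_vertex_cond\<close> selects. The sum is the formula for
  \<sigma>, so the new conductances can be handled without indices.\<close>

lemma add_vertex_cond_boundary:
  assumes new: "x' \<notin> pverts G" and inj: "inj_on x {1..m}" and range: "x ` {1..m} \<subseteq> pverts G"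
    and v: "v \<in> pverts G"
  shows "add_vertex_cond G c x' m x a v x' = (\<Sum>i=1..m. a i * dirac (x i) v)"
    and "add_vertex_cond G c x' m x a x' v = (\<Sum>i=1..m. a i * dirac (x i) v)"
proof -
  let ?c = "add_vertex_cond G c x' m x a"
  have "?c v x' = (\<Sum>i=1..m. a i * dirac (x i) v) \<and> ?c x' v = (\<Sum>i=1..m. a i * dirac (x i) v)"
  proof (cases "v \<in> x ` {1..m}")
    case True
    then obtain j where j: "j \<in> {1..m}" "v = x j"
      by auto
    have "(\<Sum>i=1..m. a i * dirac (x i) v) = (\<Sum>i=1..m. if i = j then a i else 0)"
      using j inj by (intro sum.cong) (auto simp: dirac_def dest: inj_onD)
    also have "\<dots> = a j"
      using j by simp
    finally show ?thesis
      using add_vertex_cond_new[OF new inj range j(1)] j(2) by simp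
  next
    case False
    have "(\<Sum>i=1..m. a i * dirac (x i) v) = 0"
      using False by (intro sum.neutral) (auto simp: dirac_def)
    moreover have "?c v x' = 0" "?c x' v = 0"
      using False new v
      by (auto intro!: add_vertex_cond_zero[OF new inj range] simp: doubleton_eq_iff)
    ultimately show ?thesis
      by simp
  qed
  then show "?c v x' = (\<Sum>i=1..m. a i * dirac (x i) v)" "?c x' v = (\<Sum>i=1..m. a i * dirac (x i) v)"
    by simp_all
qed

theorem proposition1:
  fixes G G' :: "'a pair_pre_digraph" and V V' :: "'a set"
    and c c' :: "'a \<Rightarrow> 'a \<Rightarrow> real"
    and lam \<alpha> :: real and m :: nat
    and \<omega> \<omega>' q p \<sigma> :: "'a \<Rightarrow> real"
    and x' :: 'a and x :: "nat \<Rightarrow> 'a" and a \<rho> :: "nat \<Rightarrow> real"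
    and \<sigma>\<^sub>i :: "nat \<Rightarrow> 'a \<Rightarrow> real"
  assumes "finite_network G c" and "V = pverts G"
    and "0 \<le> lam"
    and "\<omega> \<in> weights V"
    and "q = (\<lambda>v. weight_potential V c \<omega> v + lam)"
    and "x' \<notin> V"
    and "1 \<le> m" and "m \<le> card V"
    and "x ` {1..m} \<subseteq> V" and "inj_on x {1..m}"
    and "\<forall>i\<in>{1..m}. 0 < a i"
    and "G' = add_vertex G x' m x" and "V' = pverts G'"
    and "c' = add_vertex_cond G c x' m x a"
    and "0 < \<omega> x'"
    and "\<omega>' = (\<lambda>v. \<omega> v / sqrt (1 + (\<omega> x')\<^sup>2))"
    and "p = (\<lambda>v. weight_potential V' c' \<omega>' v + lam)"
    and "\<rho> = (\<lambda>i. sqrt (a i * \<omega> (x i) * \<omega> x'))"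
    and "\<sigma>\<^sub>i = (\<lambda>i v. \<rho> i / \<omega> (x i) * dirac (x i) v)"
    and "\<sigma> = (\<lambda>v. \<Sum>i=1..m. a i * dirac (x i) v)"
    and "\<alpha> = lam + 1 / (\<omega> x')\<^sup>2 * (\<Sum>i=1..m. (\<rho> i)\<^sup>2)"
  shows "\<forall>u :: 'a \<Rightarrow> real.
    (\<forall>v\<in>V. schroedinger V' c' p u v =
       schroedinger V c q (restrict u V) v
         + (\<Sum>i=1..m. proj1 V' (\<sigma>\<^sub>i i) u v)
         - proj2 V' \<sigma> (dirac x') u v) \<and>
    schroedinger V' c' p u x' =
      - proj2 V' (dirac x') \<sigma> u x' + \<alpha> * proj1 V' (dirac x') u x'"
proof (intro allI conjI ballI)
  fix u :: "'a \<Rightarrow> real"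
  interpret finite_network G c by fact
  have finV: "finite V"
    using assms(2) by simp
  have V': "V' = insert x' V"
    using assms(2,12,13) by (simp add: add_vertex_def)
  have finV': "finite V'"
    using finV V' by simp
  have \<omega>: "0 < \<omega> v" if "v \<in> V'" for v
    using that assms(4,15) by (auto simp: V' weights_def)
  have xV: "x i \<in> V" if "i \<in> {1..m}" for i
    using assms(9) that by auto
  have c'_old: "c' v y = c v y" if "v \<in> V" "y \<in> V" for v y
    using that assms(2,14) by (simp add: add_vertex_cond_def)
  have c'_new: "c' v x' = \<sigma> v" "c' x' v = \<sigma> v" if "v \<in> V" for v
    using that assms(2,6,9,10,14,20) by (simp_all add: add_vertex_cond_boundary)
  have "sqrt (1 + (\<omega> x')\<^sup>2) \<noteq> 0"
    using sum_power2_gt_zero_iff[of 1 "\<omega> x'"] by simp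
  from weight_potential_divide[OF this]
  have p: "p v = weight_potential V' c' \<omega> v + lam" for v
    unfolding assms(16,17) by simp
  have \<rho>2: "(\<rho> i)\<^sup>2 = a i * \<omega> (x i) * \<omega> x'" if "i \<in> {1..m}" for i
    using that assms(11,15) \<omega>[of "x i"] xV[of i] by (simp add: assms(18) V' less_imp_le)
  \<comment> \<open>Needed for general \<open>f\<close>: the constant 1 gives the total new
    conductance at \<open>x'\<close>, and \<omega> gives the sum in \<alpha>.\<close>
  have inner_\<sigma>: "inner_on V' \<sigma> f = (\<Sum>i=1..m. a i * f (x i))" for f
    unfolding assms(20) inner_on_sum inner_on_scale
    using finV' xV by (intro sum.cong) (simp_all add: V' inner_on_dirac)
  have dirac': "inner_on V' (dirac x') u = u x'"
    using finV' by (simp add: V' inner_on_dirac)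

  show "schroedinger V' c' p u v = schroedinger V c q (restrict u V) v
      + (\<Sum>i=1..m. proj1 V' (\<sigma>\<^sub>i i) u v) - proj2 V' \<sigma> (dirac x') u v" if v: "v \<in> V" for v
  proof -
    have lap: "laplacian V' c' f v = laplacian V c f v + \<sigma> v * (f v - f x')" for f
      using laplacian_insert[OF finV assms(6), of c' f v]
        laplacian_cong[of V c' v c f f] c'_old c'_new v by (simp add: V')
    \<comment> \<open>Outside \<open>V\<close> the restriction is \<open>undefined\<close>, but the
      sum and the point \<open>v\<close> stay inside \<open>V\<close>.\<close>
    have restr: "laplacian V c (restrict u V) v = laplacian V c u v"
      using v by (intro laplacian_cong) simp_all
    \<comment> \<open>The Dirac factor kills both sides unless \<open>v = x i\<close>, so values at
      \<open>x i\<close> may be replaced by values at \<open>v\<close>. The last factor is then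
      independent of \<open>i\<close>, and summing over \<open>i\<close> turns the rest into
      \<open>\<sigma> v\<close>.\<close>
    have "proj1 V' (\<sigma>\<^sub>i i) u v = a i * dirac (x i) v * (\<omega> x' / \<omega> v * u v)"
      if i: "i \<in> {1..m}" for i
    proof -
      have "proj1 V' (\<sigma>\<^sub>i i) u v = (\<rho> i)\<^sup>2 / (\<omega> (x i))\<^sup>2 * u (x i) * dirac (x i) v"
        unfolding proj2_def assms(19) inner_on_scale
        using finV' xV[OF i] by (simp add: inner_on_dirac V' power2_eq_square)
      also have "\<dots> = a i * dirac (x i) v * (\<omega> x' / \<omega> v * u v)"
        unfolding \<rho>2[OF i] using \<omega>[of "x i"] xV[OF i]
        by (simp add: V' dirac_def power2_eq_square)
      finally show ?thesis .
    qed
    then have proj: "(\<Sum>i=1..m. proj1 V' (\<sigma>\<^sub>i i) u v) = \<sigma> v * (\<omega> x' / \<omega> v * u v)"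
      unfolding assms(20) sum_distrib_right by (rule sum.cong[OF refl])
    \<comment> \<open>Here \<open>p v - q v = - \<sigma> v + \<sigma> v * \<omega> x' / \<omega>
      v\<close>.\<close>
    show ?thesis
      unfolding proj unfolding schroedinger_def p assms(5) weight_potential_def lap restr proj2_def dirac'
      using \<omega>[of v] v by (simp add: V' field_simps)
  qed

  have lap: "laplacian V' c' f x' = f x' * (\<Sum>i=1..m. a i) - inner_on V' \<sigma> f" for f
  proof -
    \<comment> \<open>At \<open>y = x'\<close> the difference vanishes, so \<sigma> may replace the
      conductance there too.\<close>
    have "laplacian V' c' f x' = (\<Sum>y\<in>V'. \<sigma> y * (f x' - f y))"
      unfolding laplacian_def by (intro sum.cong) (auto simp: V' c'_new)
    also have "\<dots> = f x' * inner_on V' \<sigma> (\<lambda>_. 1) - inner_on V' \<sigma> f"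
      by (simp add: inner_on_def sum_distrib_left sum_subtractf algebra_simps)
    finally show ?thesis
      by (simp add: inner_\<sigma>)
  qed
  \<comment> \<open>Each \<open>(\<rho> i)\<^sup>2\<close> contains one factor
    \<open>\<omega> x'\<close>, which cancels half of the square in the denominator of
    \<alpha>.\<close>
  have "(\<Sum>i=1..m. (\<rho> i)\<^sup>2) = \<omega> x' * inner_on V' \<sigma> \<omega>"
    unfolding inner_\<sigma> sum_distrib_left by (intro sum.cong) (simp_all add: \<rho>2)
  then have \<alpha>: "\<alpha> = lam + inner_on V' \<sigma> \<omega> / \<omega> x'"
    using assms(15) by (simp add: assms(21) power2_eq_square)
  \<comment> \<open>The total new conductance enters the Laplacian with a plus sign and the
    potential with a minus sign; what remains as coefficient of \<open>u x'\<close> is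
    \<alpha>.\<close>
  show "schroedinger V' c' p u x' =
      - proj2 V' (dirac x') \<sigma> u x' + \<alpha> * proj1 V' (dirac x') u x'"
    unfolding schroedinger_def p weight_potential_def lap proj2_def dirac' \<alpha>
    using assms(15) by (simp add: dirac_def field_simps)
qed

end
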